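(* Let $G$ be a finite graph without multiple edges and with at most one loop at each vertex. Let $q:D(G)\to\mathbb{H}^*=\mathbb{H}\setminus\{0\}$ be a map, and let $\mathbf{U}=(\mathbf{U}_{ef})_{e,f\in D(G)}$ be the transition matrix of the quaternionic Szegedy walk on $G$ determined by $q$, i.e. $$\mathbf{U}_{ef}=\begin{cases}2q(e)q(f^{-1})^* & \text{if } t(f)=o(e)\text{ and } f\neq e^{-1},\\ 2|q(e)|^2-1 & \text{if } f=e^{-1},\\ 0&\text{otherwise.}\end{cases}$$ Then $\mathbf{U}$ is quaternionic unitary if and only if $$\sum_{g\in D(G),\,o(g)=u}|q(g)|^2=1\quad\text{for each } u\in V(G).$$
   Context: $\mathbb{H}$ denotes the real quaternions, $x^*$ the quaternionic conjugate of $x$, $|x|=\sqrt{xx^*}$. For a square quaternionic matrix $\mathbf{M}$, $\mathbf{M}^*$ is its conjugate transpose, $(\mathbf{M}^* )_{rs}=(\mathbf{M}_{sr})^*$; $\mathbf{M}$ is (quaternionic) unitary if $\mathbf{M}^*\mathbf{M}=\mathbf{M}\mathbf{M}^*=\mathbf{I}$. $V(G)$ is the vertex set of $G$. Arcs: for each unoriented edge $uv$ of $G$, the ordered pairs $(u,v)$ and $(v,u)$ are arcs; $D(G)$ is the set of all arcs. For $e=(u,v)$, $o(e)=u$ is its origin, $t(e)=v$ its terminus, $e^{-1}=(v,u)$. A loop at $u$ gives exactly one arc $(u,u)$, so $e^{-1}=e$ if and only if $e$ is a loop.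
   Formalization: The formal theorem also assumes that every vertex of G is the origin of some arc (no isolated vertices); without this the claim fails, since at an isolated vertex the sum is empty and equals 0, while U can still be unitary. *)

theory Defs
  imports Complex_Main "HOL-Library.FuncSet"
begin

section \<open>Real quaternions\<close>

datatype quat = Quat (Qre: real) (Qi: real) (Qj: real) (Qk: real)

lemma quat_eq_iff:
  "x = y \<longleftrightarrow> Qre x = Qre y \<and> Qi x = Qi y \<and> Qj x = Qj y \<and> Qk x = Qk y"
  by (cases x; cases y) simp

instantiation quat :: ab_group_add
begin

definition "0 = Quat 0 0 0 0"

definition "x + y = Quat (Qre x + Qre y) (Qi x + Qi y) (Qj x + Qj y) (Qk x + Qk y)"

definition "- x = Quat (- Qre x) (- Qi x) (- Qj x) (- Qk x)"

definition "x - y = Quat (Qre x - Qre y) (Qi x - Qi y) (Qj x - Qj y) (Qk x - Qk y)"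

instance
  by standard
    (simp_all add: quat_eq_iff zero_quat_def plus_quat_def uminus_quat_def minus_quat_def)

end

lemma quat_add_simps [simp]:
  "Qre 0 = 0" "Qi 0 = 0" "Qj 0 = 0" "Qk 0 = 0"
  "Qre (x + y) = Qre x + Qre y" "Qi (x + y) = Qi x + Qi y"
  "Qj (x + y) = Qj x + Qj y" "Qk (x + y) = Qk x + Qk y"
  "Qre (- x) = - Qre x" "Qi (- x) = - Qi x" "Qj (- x) = - Qj x" "Qk (- x) = - Qk x"
  "Qre (x - y) = Qre x - Qre y" "Qi (x - y) = Qi x - Qi y"
  "Qj (x - y) = Qj x - Qj y" "Qk (x - y) = Qk x - Qk y"
  by (simp_all add: zero_quat_def plus_quat_def uminus_quat_def minus_quat_def)

text \<open>Hamilton's product: $i^2 = j^2 = k^2 = ijk = -1$.\<close>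

instantiation quat :: ring_1
begin

definition "1 = Quat 1 0 0 0"

definition "x * y = Quat
  (Qre x * Qre y - Qi x * Qi y - Qj x * Qj y - Qk x * Qk y)
  (Qre x * Qi y + Qi x * Qre y + Qj x * Qk y - Qk x * Qj y)
  (Qre x * Qj y - Qi x * Qk y + Qj x * Qre y + Qk x * Qi y)
  (Qre x * Qk y + Qi x * Qj y - Qj x * Qi y + Qk x * Qre y)"

instance
  by standard (simp_all add: quat_eq_iff one_quat_def times_quat_def algebra_simps)

end

lemma quat_mult_simps [simp]:
  "Qre 1 = 1" "Qi 1 = 0" "Qj 1 = 0" "Qk 1 = 0"
  "Qre (x * y) = Qre x * Qre y - Qi x * Qi y - Qj x * Qj y - Qk x * Qk y"
  "Qi (x * y) = Qre x * Qi y + Qi x * Qre y + Qj x * Qk y - Qk x * Qj y"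
  "Qj (x * y) = Qre x * Qj y - Qi x * Qk y + Qj x * Qre y + Qk x * Qi y"
  "Qk (x * y) = Qre x * Qk y + Qi x * Qj y - Qj x * Qi y + Qk x * Qre y"
  by (simp_all add: one_quat_def times_quat_def)

instantiation quat :: real_algebra_1
begin

definition "r *\<^sub>R x = Quat (r * Qre x) (r * Qi x) (r * Qj x) (r * Qk x)"

instance
  by standard (simp_all add: quat_eq_iff scaleR_quat_def algebra_simps)

end

lemma quat_scaleR_simps [simp]:
  "Qre (r *\<^sub>R x) = r * Qre x" "Qi (r *\<^sub>R x) = r * Qi x"
  "Qj (r *\<^sub>R x) = r * Qj x" "Qk (r *\<^sub>R x) = r * Qk x"
  by (simp_all add: scaleR_quat_def)

definition qcnj :: "quat \<Rightarrow> quat" where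
  "qcnj x = Quat (Qre x) (- Qi x) (- Qj x) (- Qk x)"

text \<open>$|x| = \sqrt{x x^*}$. The product $x x^*$ is a real quaternion (see \<open>mult_qcnj\<close> below);
  its real part is that real number.\<close>

definition qabs :: "quat \<Rightarrow> real" where
  "qabs x = sqrt (Qre (x * qcnj x))"

lemma mult_qcnj: "x * qcnj x = of_real ((qabs x)\<^sup>2)"
proof -
  have "(qabs x)\<^sup>2 = Qre (x * qcnj x)"
    unfolding qabs_def by (rule real_sqrt_pow2) (simp add: qcnj_def)
  then show ?thesis
    by (simp add: quat_eq_iff qcnj_def of_real_def)
qed


section \<open>Quaternionic matrices indexed by a finite set\<close>

text \<open>A square matrix with index set \<open>D\<close> is a function of two indices, of which only the
  values on \<open>D \<times> D\<close> matter.\<close>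

type_synonym 'i qmat = "'i \<Rightarrow> 'i \<Rightarrow> quat"

definition qmat_mult :: "'i set \<Rightarrow> 'i qmat \<Rightarrow> 'i qmat \<Rightarrow> 'i qmat" where
  "qmat_mult D A B = (\<lambda>r s. \<Sum>k\<in>D. A r k * B k s)"

definition qmat_id :: "'i qmat" where
  "qmat_id = (\<lambda>r s. if r = s then 1 else 0)"

definition qmat_adj :: "'i qmat \<Rightarrow> 'i qmat" where
  "qmat_adj M = (\<lambda>r s. qcnj (M s r))"

definition qmat_eq :: "'i set \<Rightarrow> 'i qmat \<Rightarrow> 'i qmat \<Rightarrow> bool" where
  "qmat_eq D A B \<longleftrightarrow> (\<forall>r\<in>D. \<forall>s\<in>D. A r s = B r s)"

definition quat_unitary :: "'i set \<Rightarrow> 'i qmat \<Rightarrow> bool" where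
  "quat_unitary D M \<longleftrightarrow>
     qmat_eq D (qmat_mult D (qmat_adj M) M) qmat_id \<and>
     qmat_eq D (qmat_mult D M (qmat_adj M)) qmat_id"


section \<open>Graphs, arcs, and the quaternionic Szegedy walk\<close>

text \<open>An edge is the set of its endpoints; a singleton \<open>{u}\<close> is a loop at \<open>u\<close>. Since the edges
  form a set, there are no multiple edges and there is at most one loop at each vertex.\<close>

locale loop_graph =
  fixes V :: "'v set" and E :: "'v set set"
  assumes finite_verts: "finite V"
    and edges: "e \<in> E \<Longrightarrow> \<exists>u\<in>V. \<exists>v\<in>V. e = {u, v}"

type_synonym 'v arc = "'v \<times> 'v"

definition arcs :: "'v set set \<Rightarrow> 'v arc set" where
  "arcs E = {(u, v). {u, v} \<in> E}"

abbreviation origin :: "'v arc \<Rightarrow> 'v" where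
  "origin \<equiv> fst"

abbreviation terminus :: "'v arc \<Rightarrow> 'v" where
  "terminus \<equiv> snd"

abbreviation arc_inv :: "'v arc \<Rightarrow> 'v arc" where
  "arc_inv \<equiv> prod.swap"

definition szegedy_matrix :: "('v arc \<Rightarrow> quat) \<Rightarrow> 'v arc qmat" where
  "szegedy_matrix q = (\<lambda>e f.
     if terminus f = origin e \<and> f \<noteq> arc_inv e then 2 * q e * qcnj (q (arc_inv f))
     else if f = arc_inv e then of_real (2 * (qabs (q e))\<^sup>2 - 1)
     else 0)"

end

theory Submission
  imports Defs
begin

text \<open>Let \<open>P\<close> be the matrix with entries \<open>P e g = q e (q g)\<^sup>*\<close> if \<open>o(e) = o(g)\<close>, and 0 otherwise,
  and let \<open>C = 2 P - I\<close>. Then \<open>U e f = C e (f\<^sup>-\<^sup>1)\<close>, so that \<open>U\<close> is the Hermitian matrix \<open>C\<close> followed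
  by a permutation, and unitarity of \<open>U\<close> amounts to \<open>C\<^sup>2 = I\<close>. With \<open>N u = \<Sum>|q g|\<^sup>2\<close>
  over the arcs \<open>g\<close> with origin \<open>u\<close> we have \<open>P\<^sup>2 = N P\<close>, hence \<open>C\<^sup>2 = 4 (N - 1) P + I\<close>.
  Since the diagonal of \<open>P\<close> has no zeros, this is \<open>I\<close> exactly if \<open>N u = 1\<close> at each vertex that is
  the origin of an arc.\<close>

lemma qcnj_simps [simp]:
  "Qre (qcnj x) = Qre x" "Qi (qcnj x) = - Qi x" "Qj (qcnj x) = - Qj x" "Qk (qcnj x) = - Qk x"
  by (simp_all add: qcnj_def)

lemma qcnj_mult: "qcnj (x * y) = qcnj y * qcnj x"
  by (simp add: quat_eq_iff algebra_simps)

lemma qcnj_qcnj [simp]: "qcnj (qcnj x) = x"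
  by (simp add: quat_eq_iff)

lemma qcnj_0 [simp]: "qcnj 0 = 0"
  by (simp add: quat_eq_iff)

lemma qcnj_1 [simp]: "qcnj 1 = 1"
  by (simp add: quat_eq_iff)

lemma qcnj_diff: "qcnj (x - y) = qcnj x - qcnj y"
  by (simp add: quat_eq_iff)

lemma qcnj_scaleR: "qcnj (r *\<^sub>R x) = r *\<^sub>R qcnj x"
  by (simp add: quat_eq_iff)

lemma qcnj_mult_self: "qcnj x * x = of_real ((qabs x)\<^sup>2)"
  unfolding mult_qcnj [symmetric] by (simp add: quat_eq_iff algebra_simps)

lemma qabs_eq_0_iff: "qabs x = 0 \<longleftrightarrow> x = 0"
proof -
  have "Qre (x * qcnj x) = (Qre x)\<^sup>2 + (Qi x)\<^sup>2 + (Qj x)\<^sup>2 + (Qk x)\<^sup>2"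
    by (simp add: power2_eq_square)
  then show ?thesis
    unfolding qabs_def quat_eq_iff by (simp add: add_nonneg_eq_0_iff)
qed

text \<open>Arcs with a common origin form a block \<open>v v^*\<close>, where \<open>v\<close>
  lists the values of \<open>q\<close> on them; such a block is a projection when \<open>v\<close>
  has norm 1, whence the name.\<close>

definition star_proj :: "('v arc \<Rightarrow> quat) \<Rightarrow> 'v arc qmat" where
  "star_proj q = (\<lambda>e g. if origin e = origin g then q e * qcnj (q g) else 0)"

definition coin :: "('v arc \<Rightarrow> quat) \<Rightarrow> 'v arc qmat" where
  "coin q = (\<lambda>e g. 2 *\<^sub>R star_proj q e g - qmat_id e g)"

text \<open>The terminus of \<open>f\<close> is the origin of \<open>arc_inv f\<close>, and the case
  \<open>f = arc_inv e\<close> becomes the diagonal of \<open>coin q\<close>.\<close>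

lemma szegedy_matrix_eq_coin: "szegedy_matrix q e f = coin q e (arc_inv f)"
proof (cases "f = arc_inv e")
  case True
  then have "arc_inv f = e"
    by simp
  with True show ?thesis
    by (simp add: szegedy_matrix_def coin_def star_proj_def qmat_id_def mult_qcnj
        scaleR_conv_of_real)
next
  case False
  then have "arc_inv f \<noteq> e"
    by auto
  with False show ?thesis
    by (auto simp: szegedy_matrix_def coin_def star_proj_def qmat_id_def scaleR_2 mult_2
        distrib_right)
qed

lemma qcnj_coin: "qcnj (coin q e g) = coin q g e"
  by (auto simp: coin_def star_proj_def qmat_id_def qcnj_diff qcnj_scaleR qcnj_mult)

lemma star_proj_idem:
  assumes "finite D"
  shows "(\<Sum>h\<in>D. star_proj q e h * star_proj q h g) =
    (\<Sum>h | h \<in> D \<and> origin h = origin e. (qabs (q h))\<^sup>2) *\<^sub>R star_proj q e g"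
proof -
  have "star_proj q e h * star_proj q h g =
      (if origin h = origin e then (qabs (q h))\<^sup>2 else 0) *\<^sub>R star_proj q e g" for h
  proof -
    \<comment> \<open>The inner factor \<open>qcnj (q h) * q h\<close> is real, hence central, and
      leaves the noncommutative product as a scalar.\<close>
    have "q e * qcnj (q h) * (q h * qcnj (q g)) = q e * (qcnj (q h) * q h) * qcnj (q g)"
      by (simp only: mult.assoc)
    then show ?thesis
      by (auto simp: star_proj_def qcnj_mult_self of_real_def)
  qed
  then show ?thesis
    using assms by (simp add: scaleR_sum_left [symmetric] sum.inter_filter)
qed

text \<open>Expanding gives 4 P^2 - 4 P + I with real, hence central, coefficients. That
  \<open>e\<close> and \<open>g\<close> lie in \<open>D\<close> makes the sums against
  \<open>qmat_id\<close> pick out a term.\<close>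

lemma coin_square:
  assumes "finite D" "e \<in> D" "g \<in> D"
  shows "(\<Sum>h\<in>D. coin q e h * coin q h g) =
    (4 * ((\<Sum>h | h \<in> D \<and> origin h = origin e. (qabs (q h))\<^sup>2) - 1)) *\<^sub>R star_proj q e g
      + qmat_id e g"
proof -
  have id_left: "(\<Sum>h\<in>D. qmat_id e h * A h) = A e" for A
  proof -
    have "qmat_id e h * A h = (if e = h then A h else 0)" for h
      by (simp add: qmat_id_def)
    then show ?thesis using assms by simp
  qed
  have id_right: "(\<Sum>h\<in>D. A h * qmat_id h g) = A g" for A
  proof -
    have "A h * qmat_id h g = (if h = g then A h else 0)" for h
      by (simp add: qmat_id_def)
    then show ?thesis using assms by simp
  qed
  let ?P = "star_proj q"
  have "(\<Sum>h\<in>D. coin q e h * coin q h g) =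
      (\<Sum>h\<in>D. 4 *\<^sub>R (?P e h * ?P h g) - 2 *\<^sub>R (?P e h * qmat_id h g)
        - 2 *\<^sub>R (qmat_id e h * ?P h g) + qmat_id e h * qmat_id h g)"
    by (simp add: coin_def algebra_simps)
  also have "\<dots> = 4 *\<^sub>R (\<Sum>h\<in>D. ?P e h * ?P h g) - 2 *\<^sub>R ?P e g - 2 *\<^sub>R ?P e g + qmat_id e g"
    by (simp only: sum.distrib sum_subtractf scaleR_sum_right [symmetric] id_left id_right)
  finally show ?thesis
    unfolding star_proj_idem [OF assms(1)] by (simp add: quat_eq_iff algebra_simps)
qed

lemma arc_inv_in_arcs: "arc_inv e \<in> arcs E \<longleftrightarrow> e \<in> arcs E"
  by (cases e) (simp add: arcs_def insert_commute)

lemma sum_arc_inv: "(\<Sum>f\<in>arcs E. \<phi> (arc_inv f)) = (\<Sum>f\<in>arcs E. \<phi> f)"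
  by (rule sum.reindex_bij_witness [of _ arc_inv arc_inv]) (auto simp: arc_inv_in_arcs)

text \<open>U U^* is C^2 after reindexing the sum by \<open>arc_inv\<close>. U^* U is C^2 with both
  outer indices inverted, so its condition follows from the other because \<open>arc_inv\<close>
  permutes the arcs.\<close>

lemma quat_unitary_szegedy_iff:
  "quat_unitary (arcs E) (szegedy_matrix q) \<longleftrightarrow>
    qmat_eq (arcs E) (qmat_mult (arcs E) (coin q) (coin q)) qmat_id"
    (is "_ \<longleftrightarrow> ?C")
proof -
  have right: "qmat_mult (arcs E) (szegedy_matrix q) (qmat_adj (szegedy_matrix q)) =
      qmat_mult (arcs E) (coin q) (coin q)"
    unfolding qmat_mult_def qmat_adj_def szegedy_matrix_eq_coin qcnj_coin
    by (intro ext) (rule sum_arc_inv)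
  have left: "qmat_mult (arcs E) (qmat_adj (szegedy_matrix q)) (szegedy_matrix q) =
      (\<lambda>e g. qmat_mult (arcs E) (coin q) (coin q) (arc_inv e) (arc_inv g))"
    by (simp add: qmat_mult_def qmat_adj_def szegedy_matrix_eq_coin qcnj_coin)
  have id: "qmat_id (arc_inv e) (arc_inv g) = qmat_id e g" for e g :: "'a arc"
    unfolding qmat_id_def by (metis swap_swap)
  have "qmat_eq (arcs E)
      (\<lambda>e g. qmat_mult (arcs E) (coin q) (coin q) (arc_inv e) (arc_inv g)) qmat_id" if ?C
    using that unfolding qmat_eq_def by (simp add: arc_inv_in_arcs id)
  then show ?thesis
    unfolding quat_unitary_def left right by blast
qed

lemma (in loop_graph) arcs_subset: "arcs E \<subseteq> V \<times> V"
  using edges by (fastforce simp: arcs_def doubleton_eq_iff)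

lemma (in loop_graph) finite_arcs: "finite (arcs E)"
  using arcs_subset finite_verts by (blast intro: finite_subset)

theorem theorem5p1:
  fixes V :: "'v set" and E :: "'v set set" and q :: "'v arc \<Rightarrow> quat"
  assumes graph: "loop_graph V E"
    and no_isolated: "\<forall>u\<in>V. \<exists>g\<in>arcs E. origin g = u"
    and q_nonzero: "q \<in> arcs E \<rightarrow> UNIV - {0}"
  shows "quat_unitary (arcs E) (szegedy_matrix q) \<longleftrightarrow>
    (\<forall>u\<in>V. (\<Sum>g | g \<in> arcs E \<and> origin g = u. (qabs (q g))\<^sup>2) = 1)"
proof -
  interpret loop_graph V E by (fact graph)
  define N where "N u = (\<Sum>g | g \<in> arcs E \<and> origin g = u. (qabs (q g))\<^sup>2)" for u
  have "quat_unitary (arcs E) (szegedy_matrix q) \<longleftrightarrow>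
      (\<forall>e\<in>arcs E. \<forall>g\<in>arcs E. (4 * (N (origin e) - 1)) *\<^sub>R star_proj q e g = 0)"
    unfolding quat_unitary_szegedy_iff qmat_eq_def qmat_mult_def N_def
    using coin_square [OF finite_arcs] by simp
  also have "\<dots> \<longleftrightarrow> (\<forall>u\<in>V. N u = 1)"
  proof
    assume vanish: "\<forall>e\<in>arcs E. \<forall>g\<in>arcs E. (4 * (N (origin e) - 1)) *\<^sub>R star_proj q e g = 0"
    show "\<forall>u\<in>V. N u = 1"
    proof
      fix u assume "u \<in> V"
      \<comment> \<open>At an isolated vertex \<open>N u\<close> would be the empty sum 0, and no
        matrix entry would detect it; \<open>no_isolated\<close> excludes this.\<close>
      then obtain e where e: "e \<in> arcs E" "origin e = u"
        using no_isolated by blast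
      \<comment> \<open>The diagonal entry at \<open>e\<close> is nonzero, so \<open>vanish\<close>
        forces its scalar factor to be 0.\<close>
      have "star_proj q e e = of_real ((qabs (q e))\<^sup>2)"
        by (simp add: star_proj_def mult_qcnj)
      moreover have "qabs (q e) \<noteq> 0"
        using q_nonzero e by (auto simp: qabs_eq_0_iff)
      ultimately have "star_proj q e e \<noteq> 0"
        by (simp del: of_real_power)
      then show "N u = 1"
        using vanish e by force
    qed
  next
    assume "\<forall>u\<in>V. N u = 1"
    then show "\<forall>e\<in>arcs E. \<forall>g\<in>arcs E. (4 * (N (origin e) - 1)) *\<^sub>R star_proj q e g = 0"
      using arcs_subset by fastforce
  qed
  finally show ?thesis
    unfolding N_def .
qed

end
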